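(* Let $H$ be a separable Hilbert space and let $S(\cdot,\cdot)$ be a continuous symmetric bilinear form on $H$, with induced linear map $\mathcal{S}:H\to H^\ast$, $(\mathcal{S}u)(v)=S(u,v)$. Suppose that $u_1,\dots,u_n\in H$ and $\phi_1,\dots,\phi_n\in H^\ast$ satisfy $\mathcal{S}(u_i)=\phi_i$ for $i=1,\dots,n$, and that $\{\phi_i\}_{i=1}^n$ are linearly independent. Then \[ \mathrm{MI}^{\phi_1,\dots,\phi_n}(S)=\mathrm{MI}(S)-c, \] where $c$ is the number of non-positive eigenvalues (counted with multiplicity) of the symmetric $n\times n$ matrix $\bigl(S(u_i,u_j)\bigr)_{i,j}$. In particular, $\mathrm{MI}(S)\ge c$.
   Context: Hilbert spaces are real; $H^\ast$ is the continuous dual of $H$. For a vector space $V$, the Morse index $\mathrm{MI}(S,V)\in\{0,1,2,\dots\}\cup\{\infty\}$ is the maximal dimension of a subspace of $V$ on which $S$ is negative definite. $\mathrm{MI}(S)=\mathrm{MI}(S,H)$, and $\mathrm{MI}^{\phi_1,\dots,\phi_n}(S)=\mathrm{MI}\bigl(S,\bigcap_{i=1}^n\mathrm{Ker}(\phi_i)\bigr)$. Convention: $\infty-c=\infty$ for finite $c$. *)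

theory Defs
  imports "HOL-Analysis.Analysis" "Jordan_Normal_Form.Char_Poly"
begin

(* dim is 0 on infinite-dimensional subspaces, hence the case distinction. *)
definition edim :: "'a::real_vector set \<Rightarrow> enat" where
  "edim W = (if \<exists>B. finite B \<and> real_vector.span B = W then enat (real_vector.dim W) else \<infinity>)"

definition negative_definite_on :: "('a::real_vector \<Rightarrow> 'a \<Rightarrow> real) \<Rightarrow> 'a set \<Rightarrow> bool" where
  "negative_definite_on S W \<longleftrightarrow> (\<forall>w\<in>W. w \<noteq> 0 \<longrightarrow> S w w < 0)"

(* The set is nonempty for every subspace V (take W = {0}), so the supremum is a maximum
   when the dimensions are bounded by a finite number, and infinity otherwise. *)
definition morse_index_on :: "('a::real_vector \<Rightarrow> 'a \<Rightarrow> real) \<Rightarrow> 'a set \<Rightarrow> enat" where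
  "morse_index_on S V =
     Sup {edim W | W. real_vector.subspace W \<and> W \<subseteq> V \<and> negative_definite_on S W}"

definition morse_index :: "('a::real_vector \<Rightarrow> 'a \<Rightarrow> real) \<Rightarrow> enat" where
  "morse_index S = morse_index_on S UNIV"

definition constrained_morse_index ::
  "nat \<Rightarrow> (nat \<Rightarrow> 'a::real_normed_vector \<Rightarrow>\<^sub>L real) \<Rightarrow> ('a \<Rightarrow> 'a \<Rightarrow> real) \<Rightarrow> enat" where
  "constrained_morse_index n \<phi> S =
     morse_index_on S (\<Inter>i<n. {x. blinfun_apply (\<phi> i) x = 0})"

definition induced_map :: "('a::real_normed_vector \<Rightarrow> 'a \<Rightarrow> real) \<Rightarrow> 'a \<Rightarrow> 'a \<Rightarrow>\<^sub>L real" where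
  "induced_map S u = Blinfun (S u)"

lemma induced_map_apply:
  assumes "bounded_bilinear S"
  shows "blinfun_apply (induced_map S u) v = S u v"
  unfolding induced_map_def
  by (simp add: bounded_linear_Blinfun_apply bounded_bilinear.bounded_linear_right[OF assms])

definition gram_mat :: "nat \<Rightarrow> ('a \<Rightarrow> 'a \<Rightarrow> real) \<Rightarrow> (nat \<Rightarrow> 'a) \<Rightarrow> real mat" where
  "gram_mat n S u = mat n n (\<lambda>(i, j). S (u i) (u j))"

(* Each eigenvalue is counted with its algebraic multiplicity. *)
definition num_nonpos_eigenvalues :: "real mat \<Rightarrow> nat" where
  "num_nonpos_eigenvalues A = (\<Sum>k | eigenvalue A k \<and> k \<le> 0. order k (char_poly A))"

end

theory Submission
  imports Defs "Jordan_Normal_Form.Spectral_Radius"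
begin

text \<open>
  Diagonalising the Gram matrix orthogonally replaces the \<open>u i\<close> by an \<open>S\<close>-orthogonal family
  \<open>e i\<close> that spans the same space and in which \<open>S (e i) (e i)\<close> runs through the eigenvalues. The
  constraints \<open>S (e i) x = 0\<close> are then imposed one at a time. If \<open>S (e i) (e i) > 0\<close>, the
  \<open>S\<close>-orthogonal projection along \<open>e i\<close> only decreases \<open>S x x\<close>, so the index does not change.
  Otherwise the constraint cuts a negative definite subspace in codimension at most one, and
  conversely a negative definite subspace of the kernel can be enlarged: by \<open>e i\<close> itself if
  \<open>S (e i) (e i) < 0\<close>, and by \<open>z + t e i\<close> with suitable \<open>z\<close> and \<open>t\<close> if \<open>e i\<close> is isotropic.
\<close>

section \<open>Orthogonal diagonalisation of real symmetric matrices\<close>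

text \<open>The complexified matrix has an eigenvalue \<open>\<mu>\<close>. Being real and symmetric
  it can be moved across the Hermitian product, which forces \<open>\<mu> = cnj \<mu>\<close>; a
  real root of the complex characteristic polynomial is a root of the real one.\<close>

lemma symmetric_real_eigenvalue_exists:
  assumes A: "(A :: real mat) \<in> carrier_mat n n" and sym: "transpose_mat A = A" and n: "n > 0"
  shows "\<exists>a. eigenvalue A a"
proof -
  let ?C = "map_mat complex_of_real A"
  have C: "?C \<in> carrier_mat n n" using A by simp
  obtain \<mu> where \<mu>: "eigenvalue ?C \<mu>"
    using spectrum_non_empty[OF C n] by (auto simp: spectrum_def)
  then obtain z where z: "z \<in> carrier_vec n" "z \<noteq> 0\<^sub>v n" "?C *\<^sub>v z = \<mu> \<cdot>\<^sub>v z"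
    using C by (auto simp: eigenvalue_def eigenvector_def)
  have symC: "transpose_mat ?C = ?C" using sym by (metis map_mat_transpose)
  have conjC: "conjugate (?C *\<^sub>v z) = ?C *\<^sub>v conjugate z"
    using A z(1) by (intro eq_vecI) (auto simp: scalar_prod_def)
  have "\<mu> * (z \<bullet>c z) = (?C *\<^sub>v z) \<bullet>c z"
    using z by simp
  also have "\<dots> = z \<bullet> (?C *\<^sub>v conjugate z)"
    using transpose_vec_mult_scalar[OF C, of "conjugate z" z] symC z(1)
    by simp
  also have "\<dots> = conjugate \<mu> * (z \<bullet>c z)"
    unfolding conjC[symmetric] z(3) using z(1) by (simp add: conjugate_smult_vec)
  finally have "\<mu> = cnj \<mu>"
    using z(1,2) by simp
  then obtain a where a: "\<mu> = complex_of_real a"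
    by (metis Reals_cases Reals_cnj_iff)
  have "poly (char_poly ?C) \<mu> = 0"
    using \<mu> eigenvalue_root_char_poly[OF C] by simp
  then have "poly (char_poly A) a = 0"
    unfolding a by (simp add: of_real_hom.char_poly_hom[OF A])
  then show ?thesis using eigenvalue_root_char_poly[OF A] by blast
qed

text \<open>Gram-Schmidt applied to a basis starting with \<open>v\<close> leaves \<open>v\<close>
  in front; normalising the columns then rescales it, whence the factor \<open>c\<close>.\<close>

lemma orthogonal_mat_with_first_col:
  fixes v :: "real vec"
  assumes v: "v \<in> carrier_vec n" "v \<noteq> 0\<^sub>v n"
  obtains W c where "W \<in> carrier_mat n n" "transpose_mat W * W = 1\<^sub>m n" "col W 0 = c \<cdot>\<^sub>v v"
proof -
  interpret cof_vec_space n "TYPE(real)" .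
  have n: "n > 0" using v by (cases n) auto
  define b where "b = basis_completion v"
  define ws where "ws = gram_schmidt n b"
  note b = basis_completion[OF v, folded b_def]
  from b(6,7) n obtain vs where bv: "b = v # vs" by (cases b) auto
  from gram_schmidt_result[OF b(2,4,5) refl, folded ws_def] b(6)
  have ws: "corthogonal ws" "set ws \<subseteq> carrier_vec n" "length ws = n" by auto
  have hd: "ws ! 0 = v"
    using gram_schmidt_hd[OF v(1), of vs] ws(3) n
    unfolding ws_def bv by (metis hd_conv_nth length_0_conv less_not_refl)
  have wsc: "ws ! i \<in> carrier_vec n" if "i < n" for i using ws that by auto
  define c where "c i = 1 / sqrt (ws ! i \<bullet> ws ! i)" for i
  define W where "W = mat n n (\<lambda>(i,j). (c j \<cdot>\<^sub>v (ws ! j)) $ i)"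
  have col: "col W j = c j \<cdot>\<^sub>v (ws ! j)" if "j < n" for j
    using that wsc[OF that] unfolding W_def by (intro eq_vecI) auto
  show thesis
  proof (rule that)
    show W: "W \<in> carrier_mat n n" by (simp add: W_def)
    show "col W 0 = c 0 \<cdot>\<^sub>v v" using col[OF n] hd by simp
    show "transpose_mat W * W = 1\<^sub>m n"
    proof (rule eq_matI)
      fix i j assume "i < dim_row (1\<^sub>m n :: real mat)" "j < dim_col (1\<^sub>m n :: real mat)"
      then have ij: "i < n" "j < n" by auto
      have "(transpose_mat W * W) $$ (i, j) = col W i \<bullet> col W j"
        using ij W by auto
      also have "\<dots> = c i * c j * (ws ! i \<bullet> ws ! j)"
        using wsc[OF ij(1)] wsc[OF ij(2)] by (simp add: col ij)
      also have "\<dots> = 1\<^sub>m n $$ (i, j)"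
      proof (cases "i = j")
        case True
        have "ws ! i \<bullet> ws ! i \<noteq> 0" "ws ! i \<bullet> ws ! i \<ge> 0"
          using corthogonalD[OF ws(1), of i i] ws(3) ij wsc[OF ij(1)]
          by (auto simp: conjugate_square_positive scalar_prod_def sum_nonneg)
        then show ?thesis using True ij by (simp add: c_def)
      next
        case False
        then show ?thesis using corthogonalD[OF ws(1), of i j] ws(3) ij by simp
      qed
      finally show "(transpose_mat W * W) $$ (i, j) = 1\<^sub>m n $$ (i, j)" .
    qed (use W in auto)
  qed
qed

lemma mult_block_diagonal_mat:
  fixes A1 :: "'a::comm_ring_1 mat"
  assumes "A1 \<in> carrier_mat m m" "A2 \<in> carrier_mat m m" "D1 \<in> carrier_mat n n" "D2 \<in> carrier_mat n n"
  shows "four_block_mat A1 (0\<^sub>m m n) (0\<^sub>m n m) D1 * four_block_mat A2 (0\<^sub>m m n) (0\<^sub>m n m) D2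
    = four_block_mat (A1 * A2) (0\<^sub>m m n) (0\<^sub>m n m) (D1 * D2)"
  using assms by (subst mult_four_block_mat[of _ m m _ n _ n _ _ m _ n]) auto

text \<open>Conjugating by an orthogonal matrix whose first column is an eigenvector splits off a
  block of size one. The other block is again symmetric, so induction applies to it.\<close>

theorem symmetric_real_diagonalisation:
  assumes "(A :: real mat) \<in> carrier_mat n n" "transpose_mat A = A"
  shows "\<exists>Q \<in> carrier_mat n n. transpose_mat Q * Q = 1\<^sub>m n \<and> diagonal_mat (transpose_mat Q * A * Q)"
  using assms
proof (induction n arbitrary: A)
  case 0
  then show ?case by (intro bexI[of _ "1\<^sub>m 0"]) (auto simp: diagonal_mat_def)
next
  case (Suc n A)
  note A = Suc.prems(1)
  obtain a v where v: "v \<in> carrier_vec (Suc n)" "v \<noteq> 0\<^sub>v (Suc n)" "A *\<^sub>v v = a \<cdot>\<^sub>v v"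
    using symmetric_real_eigenvalue_exists[OF A Suc.prems(2)] A
    by (auto simp: eigenvalue_def eigenvector_def)
  obtain W c where W: "W \<in> carrier_mat (Suc n) (Suc n)" "transpose_mat W * W = 1\<^sub>m (Suc n)"
    "col W 0 = c \<cdot>\<^sub>v v"
    using orthogonal_mat_with_first_col[OF v(1,2)] .
  define M where "M = transpose_mat W * A * W"
  have M: "M \<in> carrier_mat (Suc n) (Suc n)" using W A by (simp add: M_def)
  have symM: "transpose_mat M = M"
    unfolding M_def using W(1) A Suc.prems(2)
    by (simp add: transpose_mult[of _ "Suc n" "Suc n" _ "Suc n"] assoc_mult_mat[of _ "Suc n" "Suc n" _ "Suc n" _ "Suc n"])
  \<comment> \<open>The first column of \<open>W\<close> is still an eigenvector for
    \<open>a\<close>, and the columns of \<open>W\<close> are orthonormal.\<close>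
  have col0: "M $$ (i, 0) = (if i = 0 then a else 0)" if i: "i < Suc n" for i
  proof -
    have "A *\<^sub>v col W 0 = a \<cdot>\<^sub>v col W 0"
      using v A unfolding W(3) by (auto simp: mult_mat_vec smult_smult_assoc mult.commute)
    then have "col (A * W) 0 = a \<cdot>\<^sub>v col W 0"
      using A W(1) by (metis col_mult2 zero_less_Suc)
    then have "M $$ (i, 0) = col W i \<bullet> (a \<cdot>\<^sub>v col W 0)"
      using i A W(1) unfolding M_def
      by (simp add: assoc_mult_mat[of _ "Suc n" "Suc n" _ "Suc n" _ "Suc n"])
    also have "\<dots> = a * (transpose_mat W * W) $$ (i, 0)"
      using i W(1) by simp
    finally show ?thesis using i W(2) by simp
  qed
  define D where "D = mat n n (\<lambda>(i,j). M $$ (Suc i, Suc j))"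
  have D: "D \<in> carrier_mat n n" by (simp add: D_def)
  have symM': "M $$ (i, j) = M $$ (j, i)" if "i < Suc n" "j < Suc n" for i j
    using symM M that by (metis carrier_matD index_transpose_mat(1))
  have symD: "transpose_mat D = D"
    by (rule eq_matI) (auto simp: D_def intro: symM')
  \<comment> \<open>Symmetry carries the zeros of the first column over to the first row.\<close>
  have M_block: "M = four_block_mat (mat 1 1 (\<lambda>_. a)) (0\<^sub>m 1 n) (0\<^sub>m n 1) D"
    using M col0 symM'[of 0] by (intro eq_matI) (auto simp: D_def)
  obtain Q where Q: "Q \<in> carrier_mat n n" "transpose_mat Q * Q = 1\<^sub>m n"
    "diagonal_mat (transpose_mat Q * D * Q)"
    using Suc.IH[OF D symD] by blast
  define R where "R = four_block_mat (1\<^sub>m 1) (0\<^sub>m 1 n) (0\<^sub>m n 1) Q"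
  have R: "R \<in> carrier_mat (Suc n) (Suc n)" using Q(1) by (auto simp: R_def)
  have Rt: "transpose_mat R = four_block_mat (1\<^sub>m 1) (0\<^sub>m 1 n) (0\<^sub>m n 1) (transpose_mat Q)"
    unfolding R_def using Q(1) by (subst transpose_four_block_mat[of _ 1 1 _ n _ n]) auto
  have RR: "transpose_mat R * R = 1\<^sub>m (Suc n)"
    unfolding Rt unfolding R_def using Q(1,2)
    by (simp add: mult_block_diagonal_mat)
  have "transpose_mat R * M * R
    = four_block_mat (mat 1 1 (\<lambda>_. a)) (0\<^sub>m 1 n) (0\<^sub>m n 1) (transpose_mat Q * D * Q)"
    unfolding Rt M_block unfolding R_def using Q(1) D
    by (simp add: mult_block_diagonal_mat)
  moreover have "diagonal_mat (four_block_mat (mat 1 1 (\<lambda>_. a)) (0\<^sub>m 1 n) (0\<^sub>m n 1) (transpose_mat Q * D * Q))"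
    using Q(1,3) by (auto simp: diagonal_mat_def)
  ultimately have diag: "diagonal_mat (transpose_mat R * M * R)" by simp
  have WR: "transpose_mat (W * R) = transpose_mat R * transpose_mat W"
    using W(1) R by (rule transpose_mult)
  have "transpose_mat (W * R) * (W * R) = transpose_mat R * ((transpose_mat W * W) * R)"
    unfolding WR using W(1) R
    by (simp add: assoc_mult_mat[of _ "Suc n" "Suc n" _ "Suc n" _ "Suc n"])
  then have "transpose_mat (W * R) * (W * R) = 1\<^sub>m (Suc n)"
    using W(2) R RR by simp
  moreover have "transpose_mat (W * R) * A * (W * R) = transpose_mat R * M * R"
    unfolding WR M_def using W(1) R A
    by (simp add: assoc_mult_mat[of _ "Suc n" "Suc n" _ "Suc n" _ "Suc n"])
  ultimately show ?case using diag W(1) R by (intro bexI[of _ "W * R"]) auto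
qed

section \<open>Eigenvalue count read off a diagonal form\<close>

lemma order_prod_linear:
  "order k (\<Prod>a\<leftarrow>es. [:- a, 1:]) = count_list es (k :: real)"
proof (induction es)
  case Nil
  then show ?case by (simp add: order_1_eq_0)
next
  case (Cons a es)
  have "(\<Prod>a\<leftarrow>es. [:- a, 1:]) \<noteq> (0 :: real poly)" by (auto simp: prod_list_zero_iff)
  then have "order k ([:- a, 1:] * (\<Prod>a\<leftarrow>es. [:- a, 1:])) = order k [:- a, 1:] + count_list es k"
    using Cons by (subst order_mult) (auto simp del: mult_pCons_left)
  moreover have "order k [:- a, 1:] = (if a = k then 1 else 0)"
    by (auto simp: order_0I order_linear)
  ultimately show ?case by simp
qed

lemma num_nonpos_eigenvalues_eq_length_filter:
  assumes A: "A \<in> carrier_mat n n" and cp: "char_poly A = (\<Prod>a\<leftarrow>es. [:- a, 1:])"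
  shows "num_nonpos_eigenvalues A = length (filter (\<lambda>a. a \<le> 0) es)"
proof -
  have ev: "eigenvalue A k \<longleftrightarrow> k \<in> set es" for k
    unfolding eigenvalue_root_char_poly[OF A] cp poly_prod_list by (auto simp: prod_list_zero_iff)
  have "num_nonpos_eigenvalues A = (\<Sum>k\<in>set (filter (\<lambda>a. a \<le> 0) es). count_list (filter (\<lambda>a. a \<le> 0) es) k)"
    unfolding num_nonpos_eigenvalues_def ev cp order_prod_linear
    by (intro sum.cong) (auto simp: count_list_eq_length_filter intro!: arg_cong[of _ _ length] filter_cong)
  then show ?thesis by (simp add: sum_count_set)
qed

text \<open>Since the transpose of \<open>Q\<close> is its inverse, the conjugation is a similarity
  and preserves the characteristic polynomial, which for a diagonal matrix splits over the diagonal
  entries.\<close>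

lemma num_nonpos_eigenvalues_diagonalisation:
  assumes A: "A \<in> carrier_mat n n" and Q: "Q \<in> carrier_mat n n" "transpose_mat Q * Q = 1\<^sub>m n"
    and diag: "diagonal_mat (transpose_mat Q * A * Q)"
  shows "num_nonpos_eigenvalues A = card {i. i < n \<and> (transpose_mat Q * A * Q) $$ (i, i) \<le> 0}"
proof -
  define D where "D = transpose_mat Q * A * Q"
  have D: "D \<in> carrier_mat n n" using A Q(1) by (simp add: D_def)
  have QQ: "Q * transpose_mat Q = 1\<^sub>m n"
    using mat_mult_left_right_inverse[OF _ Q(1,2)] Q(1) by simp
  have "similar_mat_wit D A (transpose_mat Q) Q"
    using A D Q QQ by (intro similar_mat_witI[of _ _ n]) (auto simp: D_def)
  then have "char_poly A = char_poly D"
    using char_poly_similar[of D A] unfolding similar_mat_def by metis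
  also have "\<dots> = (\<Prod>a\<leftarrow>diag_mat D. [:- a, 1:])"
    using diag D by (intro char_poly_upper_triangular[OF D]) (auto simp: D_def diagonal_mat_def)
  finally have "num_nonpos_eigenvalues A = length (filter (\<lambda>a. a \<le> 0) (diag_mat D))"
    by (rule num_nonpos_eigenvalues_eq_length_filter[OF A])
  also have "\<dots> = card {i. i < n \<and> D $$ (i, i) \<le> 0}"
    using D unfolding length_filter_conv_card diag_mat_def
    by (intro arg_cong[of _ _ card]) auto
  finally show ?thesis unfolding D_def .
qed

section \<open>Morse indices tested by finite independent sets\<close>

text \<open>The finite lower bounds determine an extended natural number. Indices can thus be
  compared through finite-dimensional subspaces, with infinite values covered as well.\<close>

lemma enat_eqI_le:
  assumes "\<And>k. enat k \<le> a \<longleftrightarrow> enat k \<le> b"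
  shows "a = b"
proof (rule antisym)
  show "a \<le> b"
    using assms by (metis enat_ord_code(3) enat_ord_simps(1) linorder_le_cases not_less_eq_eq enat.exhaust)
  show "b \<le> a"
    using assms by (metis enat_ord_code(3) enat_ord_simps(1) linorder_le_cases not_less_eq_eq enat.exhaust)
qed

lemma enat_eq_plus_oneI_le:
  assumes "\<And>k. enat (Suc k) \<le> a \<longleftrightarrow> enat k \<le> b"
  shows "a = b + 1"
proof (rule enat_eqI_le)
  show "enat k \<le> a \<longleftrightarrow> enat k \<le> b + 1" for k
  proof (cases k)
    case (Suc m)
    then show ?thesis using assms[of m] by (cases b) (auto simp: one_enat_def)
  qed (simp add: zero_enat_def[symmetric])
qed

text \<open>Negative definiteness passes to subspaces, so a subspace of dimension at least
  \<open>k\<close>, possibly infinite, contains one of dimension exactly \<open>k\<close>. For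
  \<open>k = 0\<close> the zero subspace serves, hence \<open>0 \<in> V\<close>.\<close>

lemma enat_le_morse_index_on_iff:
  assumes "0 \<in> V"
  shows "enat k \<le> morse_index_on S V \<longleftrightarrow>
    (\<exists>B. independent B \<and> finite B \<and> card B = k \<and> span B \<subseteq> V \<and> negative_definite_on S (span B))"
    (is "_ \<longleftrightarrow> ?R")
proof
  assume *: "enat k \<le> morse_index_on S V"
  show ?R
  proof (cases k)
    case 0
    then show ?thesis
      using assms by (intro exI[of _ "{}"]) (auto simp: negative_definite_on_def independent_empty)
  next
    case (Suc m)
    \<comment> \<open>A strict bound below a supremum yields a member \<open>W\<close> even before
      the supremum is known to be attained.\<close>
    with * have "enat m < morse_index_on S V"
      by (metis Suc_ile_eq)
    then obtain W where W: "enat m < edim W" "real_vector.subspace W" "W \<subseteq> V" "negative_definite_on S W"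
      unfolding morse_index_on_def less_Sup_iff by blast
    obtain B where B: "B \<subseteq> W" "independent B" "W \<subseteq> span B" "card B = dim W"
      using basis_exists by blast
    have span: "span B = W"
      using B W(2) by (simp add: span_minimal subset_antisym)
    have "\<exists>C\<subseteq>B. finite C \<and> card C = k"
    proof (cases "finite B")
      case True
      then have "k \<le> card B"
        using W(1) span B(4) Suc unfolding edim_def by (auto split: if_splits)
      then show ?thesis
        using obtain_subset_with_card_n[of k B] True by (metis finite_subset)
    next
      case False
      then show ?thesis
        using infinite_arbitrarily_large[of B k] by blast
    qed
    then obtain C where C: "C \<subseteq> B" "finite C" "card C = k" by blast
    have "span C \<subseteq> W"
      using C(1) span span_mono by blast
    then show ?thesis
      using C B(2) W(3,4) independent_mono[of B C] unfolding negative_definite_on_def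
      by (intro exI[of _ C]) blast
  qed
next
  assume ?R
  then obtain B where B: "independent B" "finite B" "card B = k" "span B \<subseteq> V"
    "negative_definite_on S (span B)" by blast
  have "edim (span B) = enat k"
    using B unfolding edim_def by (auto simp: dim_eq_card_independent dim_span)
  then show "enat k \<le> morse_index_on S V"
    using B unfolding morse_index_on_def by (intro Sup_upper) (auto intro!: exI[of _ "span B"])
qed

section \<open>Projection onto and extension of negative definite subspaces\<close>

locale symmetric_bilinear_form =
  fixes S :: "'a::real_vector \<Rightarrow> 'a \<Rightarrow> real"
  assumes bilinear: "bilinear S"
    and sym: "S x y = S y x"
begin

lemmas form_simps = bilinear_ladd[OF bilinear] bilinear_radd[OF bilinear]
  bilinear_lsub[OF bilinear] bilinear_rsub[OF bilinear]
  bilinear_lmul[OF bilinear] bilinear_rmul[OF bilinear]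
  bilinear_lzero[OF bilinear] bilinear_rzero[OF bilinear]

lemma linear_right: "linear (S u)"
  using bilinear unfolding bilinear_def by (simp add: eta_contract_eq)

lemma form_sum_left: "S (\<Sum>i\<in>A. f i) y = (\<Sum>i\<in>A. S (f i) y)"
  using bilinear linear_sum[of "\<lambda>x. S x y" f A] unfolding bilinear_def by blast

lemma form_sum_right: "S x (\<Sum>i\<in>A. f i) = (\<Sum>i\<in>A. S x (f i))"
  using linear_sum[OF linear_right] .

text \<open>Gram-Schmidt for \<open>S\<close>: the new vector \<open>b\<close> is first made
  \<open>S\<close>-orthogonal to \<open>span B\<close>, giving \<open>c\<close>, and then the
  component of \<open>v\<close> along \<open>c\<close> is removed as well. The induction hypothesis
  is used for both \<open>b\<close> and \<open>v\<close>, so \<open>v\<close> is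
  generalised.\<close>

lemma negative_definite_projection:
  assumes "finite B" "negative_definite_on S (span B)"
  obtains p where "p \<in> span B" "\<And>w. w \<in> span B \<Longrightarrow> S (v - p) w = 0"
  using assms
proof (induction B arbitrary: v thesis rule: finite_induct)
  case empty
  then show ?case by (simp add: form_simps)
next
  case (insert b B)
  have neg: "negative_definite_on S (span B)"
    using insert.prems(2) span_mono[of B "insert b B"]
    unfolding negative_definite_on_def by blast
  obtain q where q: "q \<in> span B" "\<And>w. w \<in> span B \<Longrightarrow> S (b - q) w = 0"
    using insert.IH neg by blast
  obtain p where p: "p \<in> span B" "\<And>w. w \<in> span B \<Longrightarrow> S (v - p) w = 0"
    using insert.IH neg by blast
  define c where "c = b - q"
  \<comment> \<open>If \<open>c = 0\<close>, division by zero gives \<open>t = 0\<close>, and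
    orthogonality to \<open>c\<close> is trivial.\<close>
  define t where "t = S (v - p) c / S c c"
  have in_span: "x \<in> span (insert b B)" if "x \<in> span B" for x
    using that span_mono[of B "insert b B"] by blast
  have c_in: "c \<in> span (insert b B)"
    unfolding c_def using in_span[OF q(1)] span_base[of b "insert b B"] by (simp add: span_diff)
  have orth_c: "S (v - (p + t *\<^sub>R c)) c = 0"
    using insert.prems(2) c_in unfolding t_def negative_definite_on_def
    by (cases "c = 0") (force simp: form_simps)+
  show ?case
  proof (rule insert.prems(1))
    show "p + t *\<^sub>R c \<in> span (insert b B)"
      using in_span[OF p(1)] c_in by (simp add: span_add span_scale)
    fix w assume "w \<in> span (insert b B)"
    then obtain a where a: "w - a *\<^sub>R b \<in> span B"
      by (auto simp: span_breakdown_eq)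
    define w' where "w' = w - a *\<^sub>R b + a *\<^sub>R q"
    have w': "w' \<in> span B"
      unfolding w'_def using a q(1) by (simp add: span_add span_scale)
    have w: "w = w' + a *\<^sub>R c"
      by (simp add: w'_def c_def algebra_simps)
    have "S (v - (p + t *\<^sub>R c)) w' = S (v - p) w' - t * S c w'"
      by (simp add: form_simps)
    then have "S (v - (p + t *\<^sub>R c)) w' = 0"
      using p(2)[OF w'] q(2)[OF w'] by (simp add: c_def)
    then show "S (v - (p + t *\<^sub>R c)) w = 0"
      using orth_c bilinear_radd[OF bilinear] bilinear_rmul[OF bilinear] unfolding w by simp
  qed
qed

text \<open>The cross terms vanish, so \<open>S w w\<close> is the sum of the contributions of
  \<open>span B\<close> and of the line through \<open>v\<close>. A vector \<open>v\<close> in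
  \<open>span B\<close> would satisfy \<open>S v v = 0\<close>.\<close>

lemma negative_definite_insert:
  assumes "negative_definite_on S (span B)" "S v v < 0" "\<And>w. w \<in> span B \<Longrightarrow> S v w = 0"
  shows "v \<notin> span B" "negative_definite_on S (span (insert v B))"
proof -
  show "v \<notin> span B" using assms(2,3) by force
  show "negative_definite_on S (span (insert v B))"
    unfolding negative_definite_on_def
  proof (intro ballI impI)
    fix w assume w: "w \<in> span (insert v B)" "w \<noteq> 0"
    then obtain a where a: "w - a *\<^sub>R v \<in> span B"
      by (auto simp: span_breakdown_eq)
    define z where "z = w - a *\<^sub>R v"
    have z: "z \<in> span B" "S v z = 0" "S z v = 0" "w = z + a *\<^sub>R v"
      using a assms(3)[of z] sym[of z v] by (auto simp: z_def)
    have "S w w = S z z + a * a * S v v"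
      using z(2,3) unfolding z(4) by (simp add: form_simps)
    moreover have "z \<noteq> 0 \<Longrightarrow> S z z < 0"
      using assms(1) z(1) unfolding negative_definite_on_def by blast
    moreover have "a \<noteq> 0 \<Longrightarrow> a * a * S v v < 0"
      using assms(2) by (intro mult_pos_neg) (auto simp: zero_less_mult_iff)
    ultimately show "S w w < 0"
      using w(2) z(4) by (cases "z = 0"; cases "a = 0") (auto simp: form_simps)
  qed
qed

section \<open>The effect of one further constraint\<close>

text \<open>\<open>X\<close> plays the part of the subspace cut out by the earlier constraints;
  \<open>u_in\<close> then says that \<open>u\<close> is \<open>S\<close>-orthogonal to the earlier
  vectors.\<close>

context
  fixes X :: "'a set" and u :: 'a
  assumes subspace: "real_vector.subspace X" and u_in: "u \<in> X"
begin

lemma subspace_kernel: "real_vector.subspace {x \<in> X. S u x = 0}"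
  using subspace by (auto simp: real_vector.subspace_def form_simps)

lemma morse_index_kernel_pos:
  assumes "S u u > 0"
  shows "morse_index_on S X = morse_index_on S {x \<in> X. S u x = 0}"
proof -
  let ?X' = "{x \<in> X. S u x = 0}"
  have "enat k \<le> morse_index_on S X \<longleftrightarrow> enat k \<le> morse_index_on S ?X'" for k
  proof
    assume "enat k \<le> morse_index_on S X"
    then obtain B where B: "independent B" "finite B" "card B = k" "span B \<subseteq> X"
      "negative_definite_on S (span B)"
      using enat_le_morse_index_on_iff[of X k S] subspace_0[OF subspace] by blast
    define P where "P x = x - (S u x / S u u) *\<^sub>R u" for x
    have lin: "linear P"
      unfolding P_def by (rule linearI) (simp_all add: form_simps algebra_simps add_divide_distrib)
    have ker: "S u (P x) = 0" for x
      using assms by (simp add: P_def form_simps)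
    have SP: "S (P x) (P x) \<le> S x x" for x
    proof -
      have "S (P x) (P x) = S x x - (S u x)\<^sup>2 / S u u"
        using assms sym[of x u]
        by (simp add: P_def form_simps power2_eq_square field_simps)
      then show ?thesis using assms by simp
    qed
    \<comment> \<open>\<open>P x = 0\<close> would give \<open>0 \<le> S x x\<close>, against
      negative definiteness unless \<open>x = 0\<close>.\<close>
    have inj: "inj_on P (span B)"
    proof (subst linear_inj_on_iff_eq_0[OF lin subspace_span], intro ballI impI)
      fix x assume x: "x \<in> span B" "P x = 0"
      then show "x = 0"
        using SP[of x] B(5) unfolding negative_definite_on_def by (force simp: form_simps)
    qed
    have "independent (P ` B)"
      using linear_independent_injective_image[OF lin B(1) inj] .
    moreover have "card (P ` B) = k"
      using B(3) card_image[OF inj_on_subset[OF inj span_superset]] by simp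
    moreover have sp: "span (P ` B) = P ` span B"
      using linear_span_image[OF lin] by simp
    moreover have "P ` span B \<subseteq> ?X'"
    proof clarify
      fix x assume "x \<in> span B"
      then show "P x \<in> X \<and> S u (P x) = 0"
        using B(4) ker u_in subspace unfolding P_def
        by (auto intro!: subspace_diff subspace_scale simp: P_def)
    qed
    moreover have "negative_definite_on S (P ` span B)"
      unfolding negative_definite_on_def
    proof clarify
      fix x assume "x \<in> span B" "P x \<noteq> 0"
      then show "S (P x) (P x) < 0"
        using SP[of x] B(5) linear_0[OF lin] unfolding negative_definite_on_def by force
    qed
    ultimately show "enat k \<le> morse_index_on S ?X'"
      unfolding enat_le_morse_index_on_iff[OF subspace_0[OF subspace_kernel]]
      using B(2) by (intro exI[of _ "P ` B"]) (simp only: sp finite_imageI simp_thms)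
  next
    assume "enat k \<le> morse_index_on S ?X'"
    then show "enat k \<le> morse_index_on S X"
      using enat_le_morse_index_on_iff[of ?X' k S] enat_le_morse_index_on_iff[of X k S]
        subspace_0[OF subspace_kernel] subspace_0[OF subspace] by blast
  qed
  then show ?thesis by (rule enat_eqI_le)
qed

text \<open>The vector \<open>v\<close> shows that the constraint is not vacuous on
  \<open>X\<close>. One direction loses at most one dimension by cutting with a hyperplane; the
  other adds to \<open>B\<close> a negative vector that is \<open>S\<close>-orthogonal to
  \<open>span B\<close>.\<close>

lemma morse_index_kernel_nonpos:
  assumes "S u u \<le> 0" and v: "v \<in> X" "S u v \<noteq> 0"
  shows "morse_index_on S X = morse_index_on S {x \<in> X. S u x = 0} + 1"
proof -
  let ?X' = "{x \<in> X. S u x = 0}"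
  have "enat (Suc k) \<le> morse_index_on S X \<longleftrightarrow> enat k \<le> morse_index_on S ?X'" for k
  proof
    assume "enat (Suc k) \<le> morse_index_on S X"
    then obtain B where B: "independent B" "finite B" "card B = Suc k" "span B \<subseteq> X"
      "negative_definite_on S (span B)"
      using enat_le_morse_index_on_iff[of X "Suc k" S] subspace_0[OF subspace] by blast
    have "\<exists>C. independent C \<and> finite C \<and> card C = k \<and> span C \<subseteq> {x \<in> span B. S u x = 0}"
    proof (cases "\<forall>b\<in>B. S u b = 0")
      case True
      obtain C where C: "C \<subseteq> B" "card C = k"
        using obtain_subset_with_card_n[of k B] B(3) by auto
      have "span C \<subseteq> {x \<in> span B. S u x = 0}"
      proof (rule span_minimal)
        show "C \<subseteq> {x \<in> span B. S u x = 0}" using C(1) True span_base by blast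
        show "real_vector.subspace {x \<in> span B. S u x = 0}"
          using subspace_span[of B] by (auto simp: real_vector.subspace_def form_simps)
      qed
      then show ?thesis
        using C B(1,2) independent_mono finite_subset by blast
    next
      case False
      then obtain b where b: "b \<in> B" "S u b \<noteq> 0" by blast
      \<comment> \<open>The projection onto the kernel of \<open>S u\<close> along \<open>b\<close>.
        It annihilates only multiples of \<open>b\<close>, and these meet the span of the remaining
        basis vectors in 0.\<close>
      define P where "P x = x - (S u x / S u b) *\<^sub>R b" for x
      have lin: "linear P"
        unfolding P_def by (rule linearI) (simp_all add: form_simps algebra_simps add_divide_distrib)
      have b_notin: "b \<notin> span (B - {b})"
        using B(1) b(1) dependent_def by blast
      have inj: "inj_on P (span (B - {b}))"
      proof (subst linear_inj_on_iff_eq_0[OF lin subspace_span], intro ballI impI)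
        fix x assume x: "x \<in> span (B - {b})" "P x = 0"
        show "x = 0"
        proof (rule ccontr)
          assume "x \<noteq> 0"
          with x(2) have "S u x / S u b \<noteq> 0" by (auto simp: P_def)
          moreover have "(S u x / S u b) *\<^sub>R b \<in> span (B - {b})"
            using x by (simp add: P_def)
          ultimately show False
            using b_notin span_scale[of "(S u x / S u b) *\<^sub>R b" "B - {b}" "inverse (S u x / S u b)"] by simp
        qed
      qed
      have "independent (P ` (B - {b}))"
        using linear_independent_injective_image[OF lin independent_mono[OF B(1)] inj] by blast
      moreover have "card (P ` (B - {b})) = k"
        using B(3) b(1) card_image[OF inj_on_subset[OF inj span_superset]] by simp
      moreover have "span (P ` (B - {b})) \<subseteq> {x \<in> span B. S u x = 0}"
      proof (rule span_minimal)
        show "P ` (B - {b}) \<subseteq> {x \<in> span B. S u x = 0}"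
          using b by (auto simp: P_def form_simps intro!: span_diff span_scale intro: span_base)
        show "real_vector.subspace {x \<in> span B. S u x = 0}"
          using subspace_span[of B] by (auto simp: real_vector.subspace_def form_simps)
      qed
      ultimately show ?thesis
        using B(2) by (intro exI[of _ "P ` (B - {b})"]) auto
    qed
    then obtain C where C: "independent C" "finite C" "card C = k"
      "span C \<subseteq> {x \<in> span B. S u x = 0}" by blast
    moreover have "span C \<subseteq> ?X'" "negative_definite_on S (span C)"
      using C(4) B(4,5) unfolding negative_definite_on_def by blast+
    ultimately show "enat k \<le> morse_index_on S ?X'"
      using enat_le_morse_index_on_iff[of ?X' k S] subspace_0[OF subspace_kernel] by blast
  next
    assume "enat k \<le> morse_index_on S ?X'"
    then obtain B where B: "independent B" "finite B" "card B = k" "span B \<subseteq> ?X'"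
      "negative_definite_on S (span B)"
      using enat_le_morse_index_on_iff[of ?X' k S] subspace_0[OF subspace_kernel] by blast
    have "\<exists>y\<in>X. S y y < 0 \<and> (\<forall>w\<in>span B. S y w = 0)"
    proof (cases "S u u < 0")
      case True
      \<comment> \<open>Here \<open>y = u\<close>: \<open>span B\<close> lies in the kernel of
        \<open>S u\<close>.\<close>
      then show ?thesis using u_in B(4) by blast
    next
      case False
      then have uu: "S u u = 0" using assms(1) by simp
      \<comment> \<open>Subtracting \<open>p\<close> makes \<open>v\<close>
        \<open>S\<close>-orthogonal to \<open>span B\<close> and keeps its pairing with
        \<open>u\<close>, because \<open>S u p = 0\<close>. As \<open>u\<close> is isotropic, moving
        along \<open>u\<close> gives \<open>S\<close> any prescribed value on the diagonal.\<close>
      obtain p where p: "p \<in> span B" "\<And>w. w \<in> span B \<Longrightarrow> S (v - p) w = 0"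
        using negative_definite_projection[OF B(2,5)] by blast
      define z where "z = v - p"
      \<comment> \<open>\<open>t\<close> solves \<open>S (z + t u) (z + t u) = S z z + 2 t S u v = - 1\<close>\<close>
      define t where "t = (- 1 - S z z) / (2 * S u v)"
      have z: "z \<in> X" "S u z = S u v" "S z u = S u v"
        using v p(1) B(4) subspace sym[of z u]
        by (auto simp: z_def form_simps intro!: subspace_diff)
      have "S (z + t *\<^sub>R u) (z + t *\<^sub>R u) = S z z + 2 * t * S u v"
        using uu z by (simp add: form_simps)
      also have "\<dots> = - 1" using v(2) by (simp add: t_def field_simps)
      finally have "S (z + t *\<^sub>R u) (z + t *\<^sub>R u) < 0" by simp
      moreover have "S (z + t *\<^sub>R u) w = 0" if "w \<in> span B" for w
        using p(2)[OF that] that B(4) by (auto simp: z_def form_simps)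
      moreover have "z + t *\<^sub>R u \<in> X"
        using z(1) u_in subspace by (simp add: subspace_add subspace_scale)
      ultimately show ?thesis by blast
    qed
    then obtain y where y: "y \<in> X" "S y y < 0" "\<And>w. w \<in> span B \<Longrightarrow> S y w = 0" by blast
    note ins = negative_definite_insert[OF B(5) y(2,3)]
    have "independent (insert y B)" using ins(1) B(1) independent_insertI by blast
    moreover have "card (insert y B) = Suc k" 
      using B(2,3) ins(1) span_base[of y B] by (auto simp: card_insert_if)
    moreover have "span (insert y B) \<subseteq> X"
      using y(1) B(4) span_superset[of B] by (intro span_minimal subspace) auto
    ultimately show "enat (Suc k) \<le> morse_index_on S X"
      using enat_le_morse_index_on_iff[of X "Suc k" S] subspace_0[OF subspace] B(2) ins(2) by blast
  qed
  then show ?thesis by (rule enat_eq_plus_oneI_le)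
qed

end

end

section \<open>Dual vectors for independent functionals\<close>

text \<open>\<open>P\<close> subtracts the components along the dual vectors found so far and so
  lands in the common kernel of the first \<open>n\<close> functionals. Independence makes
  \<open>f n\<close> nonzero there, which provides the next dual vector \<open>w\<close> after
  scaling.\<close>

lemma linear_dual_basis_exists:
  fixes f :: "nat \<Rightarrow> 'a::real_vector \<Rightarrow> real"
  assumes "\<And>i. i < n \<Longrightarrow> linear (f i)"
    and "\<And>c i. (\<And>x. (\<Sum>i<n. c i * f i x) = 0) \<Longrightarrow> i < n \<Longrightarrow> c i = 0"
  shows "\<exists>x. \<forall>i<n. \<forall>j<n. f i (x j) = (if i = j then 1 else 0)"
  using assms
proof (induction n)
  case (Suc n)
  have "c i = 0" if "\<And>x. (\<Sum>i<n. c i * f i x) = 0" "i < n" for c i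
    using Suc.prems(2)[of "c(n := 0)" i] that by simp
  then obtain x where x: "\<And>i j. i < n \<Longrightarrow> j < n \<Longrightarrow> f i (x j) = (if i = j then 1 else 0)"
    using Suc.IH Suc.prems(1) by (metis less_SucI)
  note lin = Suc.prems(1)
  define P where "P z = z - (\<Sum>j<n. f j z *\<^sub>R x j)" for z
  have fP: "f i (P z) = f i z - (\<Sum>j<n. f j z * f i (x j))" if "i < Suc n" for i z
    using lin[OF that] by (simp add: P_def linear_diff linear_sum linear_scale)
  have ker: "f i (P z) = 0" if "i < n" for i z
    using that fP[of i z] x[of i] by (simp add: if_distrib[of "\<lambda>y. _ * y"] cong: if_cong)
  obtain z where z: "f n (P z) \<noteq> 0"
  proof (rule ccontr)
    assume "\<not> thesis"
    with that have "f n (P z) = 0" for z by blast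
    \<comment> \<open>Otherwise \<open>f n\<close> would be a combination of the earlier
      functionals, a relation with coefficient 1 at \<open>n\<close>.\<close>
    then have "(\<Sum>i<Suc n. ((\<lambda>i. - f n (x i))(n := 1)) i * f i z) = 0" for z
      using fP[of n z] by (simp add: sum_negf mult.commute)
    from Suc.prems(2)[OF this, of n] show False by simp
  qed
  define w where "w = (1 / f n (P z)) *\<^sub>R P z"
  have w: "f i w = (if i = n then 1 else 0)" if "i < Suc n" for i
    using that z ker[of i z] lin[OF that] by (auto simp: w_def linear_scale less_Suc_eq)
  show ?case
  \<comment> \<open>The correction by \<open>w\<close> kills \<open>f n\<close> on the old vectors;
    the first \<open>n\<close> functionals vanish on \<open>w\<close>, so their values stay.\<close>
  proof (intro exI[of _ "(\<lambda>j. x j - f n (x j) *\<^sub>R w)(n := w)"] allI impI)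
    fix i j assume "i < Suc n" "j < Suc n"
    then show "f i (((\<lambda>j. x j - f n (x j) *\<^sub>R w)(n := w)) j) = (if i = j then 1 else 0)"
      using w[of i] x[of i j] lin[of i] by (auto simp: less_Suc_eq linear_diff linear_scale)
  qed
qed simp

section \<open>Imposing an orthogonal family of constraints\<close>

context symmetric_bilinear_form
begin

text \<open>Orthogonality puts \<open>e n\<close> into the kernel of the earlier constraints, and
  duality puts \<open>y n\<close> there with nonzero pairing against \<open>e n\<close>. Both are
  what the one-constraint step asks for.\<close>

theorem morse_index_orthogonal_family:
  fixes n :: nat
  assumes orth: "\<And>i j. i < n \<Longrightarrow> j < n \<Longrightarrow> i \<noteq> j \<Longrightarrow> S (e i) (e j) = 0"
    and dual: "\<And>i j. i < n \<Longrightarrow> j < n \<Longrightarrow> S (e i) (y j) = (if i = j then 1 else 0)"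
  shows "morse_index S = morse_index_on S {x. \<forall>i<n. S (e i) x = 0}
    + enat (card {i. i < n \<and> S (e i) (e i) \<le> 0})"
  using assms
proof (induction n)
  case 0
  then show ?case by (simp add: morse_index_def zero_enat_def[symmetric])
next
  case (Suc n)
  let ?X = "{x. \<forall>i<n. S (e i) x = 0}"
  have sub: "real_vector.subspace ?X" by (simp add: real_vector.subspace_def form_simps)
  have en: "e n \<in> ?X" and yn: "y n \<in> ?X" "S (e n) (y n) \<noteq> 0"
    using Suc.prems by auto
  have ker: "{x. \<forall>i<Suc n. S (e i) x = 0} = {x \<in> ?X. S (e n) x = 0}"
    by (auto simp: less_Suc_eq)
  have split: "{i. i < Suc n \<and> S (e i) (e i) \<le> 0} =
    (if S (e n) (e n) \<le> 0 then insert n {i. i < n \<and> S (e i) (e i) \<le> 0}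
     else {i. i < n \<and> S (e i) (e i) \<le> 0})"
    by (auto simp: less_Suc_eq)
  have IH: "morse_index S = morse_index_on S ?X + enat (card {i. i < n \<and> S (e i) (e i) \<le> 0})"
    using Suc by simp
  show ?case
  proof (cases "S (e n) (e n) \<le> 0")
    case True
    then show ?thesis
      using IH morse_index_kernel_nonpos[OF sub en True yn] unfolding ker split
      by (simp add: add.assoc one_enat_def)
  next
    case False
    then show ?thesis
      using IH morse_index_kernel_pos[OF sub en] unfolding ker split by simp
  qed
qed

end

section \<open>Passage to an orthogonal family by diagonalising the Gram matrix\<close>

theorem theorem1p3:
  fixes S :: "'a::{real_inner, complete_space} \<Rightarrow> 'a \<Rightarrow> real"
    and u :: "nat \<Rightarrow> 'a"
    and \<phi> :: "nat \<Rightarrow> 'a \<Rightarrow>\<^sub>L real"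
    and n :: nat
  assumes "separable_space (euclidean :: 'a topology)"
    and "bounded_bilinear S"
    and "\<And>x y. S x y = S y x"
    and "\<And>i. i < n \<Longrightarrow> induced_map S (u i) = \<phi> i"
    and "inj_on \<phi> {..<n}"
    and "real_vector.independent (\<phi> ` {..<n})"
  shows "constrained_morse_index n \<phi> S = morse_index S - enat (num_nonpos_eigenvalues (gram_mat n S u))
    \<and> enat (num_nonpos_eigenvalues (gram_mat n S u)) \<le> morse_index S"
proof -
  interpret symmetric_bilinear_form S
  proof
    show "bilinear S"
      unfolding bilinear_def
      using bounded_bilinear.bounded_linear_left[OF assms(2)]
        bounded_bilinear.bounded_linear_right[OF assms(2)] bounded_linear.linear by blast
  qed (rule assms(3))
  have \<phi>: "blinfun_apply (\<phi> i) x = S (u i) x" if "i < n" for i x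
    using assms(4)[OF that] induced_map_apply[OF assms(2)] by metis
  \<comment> \<open>Injectivity of \<open>\<phi>\<close> turns independence of its image as a set
    into independence of the indexed family.\<close>
  have indep: "c i = 0" if c: "\<And>x. (\<Sum>i<n. c i * S (u i) x) = 0" and i: "i < n" for c i
  proof -
    have "(\<Sum>i<n. c i *\<^sub>R \<phi> i) = 0"
      using c by (intro blinfun_eqI) (simp add: blinfun.sum_left blinfun.scaleR_left \<phi>)
    then have "(\<Sum>f\<in>\<phi> ` {..<n}. c (the_inv_into {..<n} \<phi> f) *\<^sub>R f) = 0"
      by (simp add: sum.reindex[OF assms(5)] the_inv_into_f_f[OF assms(5)])
    then have "c (the_inv_into {..<n} \<phi> (\<phi> i)) = 0"
      using independentD[OF assms(6)[folded dependent_raw_def] _ subset_refl, of "\<lambda>f. c (the_inv_into {..<n} \<phi> f)" "\<phi> i"] i by blast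
    then show "c i = 0" using i by (simp add: the_inv_into_f_f[OF assms(5)])
  qed
  obtain x where x: "\<And>i j. i < n \<Longrightarrow> j < n \<Longrightarrow> S (u i) (x j) = (if i = j then 1 else 0)"
    using linear_dual_basis_exists[of n "\<lambda>i. S (u i)"] linear_right indep by blast
  define G where "G = gram_mat n S u"
  have G: "G \<in> carrier_mat n n" "transpose_mat G = G"
    by (auto simp: G_def gram_mat_def sym intro!: eq_matI)
  obtain Q where Q: "Q \<in> carrier_mat n n" "transpose_mat Q * Q = 1\<^sub>m n"
    "diagonal_mat (transpose_mat Q * G * Q)"
    using symmetric_real_diagonalisation[OF G] by blast
  have QQ: "Q * transpose_mat Q = 1\<^sub>m n"
    using mat_mult_left_right_inverse[OF _ Q(1,2)] Q(1) by simp
  \<comment> \<open>Both families are transformed by the same \<open>Q\<close>: an orthogonal matrix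
    is its own inverse transpose, so duality survives.\<close>
  define e where "e j = (\<Sum>i<n. (Q $$ (i, j)) *\<^sub>R u i)" for j
  define y where "y j = (\<Sum>i<n. (Q $$ (i, j)) *\<^sub>R x i)" for j
  have Se: "S (e i) z = (\<Sum>k<n. Q $$ (k, i) * S (u k) z)" for i z
    by (simp add: e_def form_sum_left form_simps)
  have ee: "S (e i) (e j) = (transpose_mat Q * G * Q) $$ (i, j)" if ij: "i < n" "j < n" for i j
  proof -
    have "S (e i) (e j) = (\<Sum>l<n. (\<Sum>k<n. Q $$ (k, i) * S (u k) (u l)) * Q $$ (l, j))"
      unfolding Se e_def[of j] form_sum_right form_simps
      by (simp add: sum_distrib_left sum_distrib_right mult_ac)
    also have "\<dots> = (transpose_mat Q * G * Q) $$ (i, j)"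
      using ij Q(1) G(1)
      by (simp add: scalar_prod_def G_def gram_mat_def atLeast0LessThan)
    finally show ?thesis .
  qed
  have ey: "S (e i) (y j) = (if i = j then 1 else 0)" if ij: "i < n" "j < n" for i j
  proof -
    have "S (e i) (y j) = (\<Sum>k<n. Q $$ (k, i) * Q $$ (k, j))"
      unfolding Se y_def form_sum_right form_simps
      by (intro sum.cong) (simp_all add: x if_distrib[of "\<lambda>y. _ * y"] cong: if_cong)
    also have "\<dots> = (transpose_mat Q * Q) $$ (i, j)"
      using ij Q(1) by (simp add: scalar_prod_def atLeast0LessThan)
    finally show ?thesis using Q(2) ij by simp
  qed
  \<comment> \<open>Inverts the change of family, so that the old and the new constraints have the
    same common kernel.\<close>
  have ue: "S (u i) z = (\<Sum>j<n. Q $$ (i, j) * S (e j) z)" if i: "i < n" for i z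
  proof -
    have "(\<Sum>j<n. Q $$ (i, j) * S (e j) z)
      = (\<Sum>k<n. (\<Sum>j<n. Q $$ (i, j) * Q $$ (k, j)) * S (u k) z)"
      unfolding Se by (simp add: sum_distrib_left sum_distrib_right mult_ac) (rule sum.swap)
    also have "\<dots> = (\<Sum>k<n. (Q * transpose_mat Q) $$ (i, k) * S (u k) z)"
      using i Q(1) by (intro sum.cong) (auto simp: scalar_prod_def atLeast0LessThan)
    also have "\<dots> = S (u i) z"
      unfolding QQ using i by (simp add: if_distrib[of "\<lambda>y. y * _"] cong: if_cong)
    finally show ?thesis by simp
  qed
  have V: "(\<Inter>i<n. {x. blinfun_apply (\<phi> i) x = 0}) = {x. \<forall>i<n. S (e i) x = 0}"
  proof (intro Set.set_eqI iffI)
    fix z assume "z \<in> (\<Inter>i<n. {x. blinfun_apply (\<phi> i) x = 0})"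
    then have "S (u i) z = 0" if "i < n" for i using that \<phi> by auto
    then show "z \<in> {x. \<forall>i<n. S (e i) x = 0}" by (simp add: Se)
  next
    fix z assume "z \<in> {x. \<forall>i<n. S (e i) x = 0}"
    then show "z \<in> (\<Inter>i<n. {x. blinfun_apply (\<phi> i) x = 0})" by (simp add: \<phi> ue)
  qed
  have "num_nonpos_eigenvalues G = card {i. i < n \<and> S (e i) (e i) \<le> 0}"
    unfolding num_nonpos_eigenvalues_diagonalisation[OF G(1) Q]
    by (intro arg_cong[of _ _ card]) (auto simp: ee)
  moreover have "S (e i) (e j) = 0" if "i < n" "j < n" "i \<noteq> j" for i j
    using Q(1,3) that by (simp add: ee diagonal_mat_def)
  ultimately have "morse_index S = constrained_morse_index n \<phi> S + enat (num_nonpos_eigenvalues G)"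
    using morse_index_orthogonal_family[of n e y] ey
    unfolding constrained_morse_index_def V by simp
  \<comment> \<open>The count is finite and cancels; an infinite index stays infinite under
    subtraction.\<close>
  then show ?thesis unfolding G_def[symmetric] by (cases "constrained_morse_index n \<phi> S") auto
qed

end
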